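(* It is not true that for every graph $H$ the class of graphs excluding induced subdivisions of $H$ is $\chi$-bounded. That is, there exists a graph $H$ such that the class of all graphs $G$ having no induced subgraph isomorphic to a subdivision of $H$ is not $\chi$-bounded.
   Context: Graphs are finite and simple. A subdivision of a graph $H$ is any graph obtained from $H$ by replacing edges by internally vertex-disjoint paths of length at least $1$ with the same endpoints, whose internal vertices are new ($H$ itself counts as a subdivision of $H$). $\chi(G)$ denotes the chromatic number of $G$ and $\omega(G)$ the clique number (maximum size of a set of pairwise adjacent vertices). A class of graphs is $\chi$-bounded if there is a function $f\colon\mathbb{N}\to\mathbb{N}$ such that $\chi(G)\leq f(\omega(G))$ holds for every graph $G$ in the class. *)

theory Defs
  imports "Graph_Theory.Graph_Theory"
begin

text \<open>
  A finite simple graph is a \<^locale>\<open>pair_graph\<close>: a finite vertex set with a symmetric, irreflexive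
  set of arcs, an undirected edge between \<open>u\<close> and \<open>v\<close> being the pair of arcs \<open>(u, v)\<close>, \<open>(v, u)\<close>.
\<close>

definition proper_colouring :: "'a pair_pre_digraph \<Rightarrow> nat \<Rightarrow> ('a \<Rightarrow> nat) \<Rightarrow> bool" where
  "proper_colouring G k c \<longleftrightarrow>
     (\<forall>v\<in>pverts G. c v < k) \<and> (\<forall>(u, v)\<in>parcs G. c u \<noteq> c v)"

definition chromatic_number :: "'a pair_pre_digraph \<Rightarrow> nat" where
  "chromatic_number G = (LEAST k. \<exists>c. proper_colouring G k c)"

definition is_clique :: "'a pair_pre_digraph \<Rightarrow> 'a set \<Rightarrow> bool" where
  "is_clique G K \<longleftrightarrow>
     K \<subseteq> pverts G \<and> (\<forall>u\<in>K. \<forall>v\<in>K. u \<noteq> v \<longrightarrow> (u, v) \<in> parcs G)"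

definition clique_number :: "'a pair_pre_digraph \<Rightarrow> nat" where
  "clique_number G = Max {card K |K. is_clique G K}"

definition chi_bounded :: "'a pair_pre_digraph set \<Rightarrow> bool" where
  "chi_bounded \<C> \<longleftrightarrow>
     (\<exists>f::nat \<Rightarrow> nat. \<forall>G\<in>\<C>. chromatic_number G \<le> f (clique_number G))"

text \<open>
  \<^const>\<open>subdivision\<close> generates the subdivisions of \<open>H\<close> by repeatedly inserting a new vertex into an
  edge, which amounts to replacing the edges of \<open>H\<close> by internally disjoint paths. The new
  vertices come from the vertex type of \<open>H\<close>, so that type has to be infinite: over a finite type
  some subdivisions would be missing. Hence \<open>H\<close> lives on \<^typ>\<open>nat\<close>, which represents every finite
  graph up to isomorphism.
\<close>

definition has_induced_subdivision :: "'a pair_pre_digraph \<Rightarrow> nat pair_pre_digraph \<Rightarrow> bool" where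
  "has_induced_subdivision G H \<longleftrightarrow>
     (\<exists>S T. subdivision_pair H S \<and> induced_subgraph T (with_proj G) \<and> digraph_iso (with_proj S) T)"

end

theory Submission
  imports Defs "HOL-Library.Countable"
begin

text \<open>
  The graph \<open>H\<close> is the 3-cube; the graphs of unbounded chromatic number are Burling's triangle-free
  graphs, in a purely combinatorial form.

  All of Burling's graphs sit inside one infinite oriented graph \<open>arrow\<close>, whose vertex set carries
  a forest order \<open>below\<close> tied to the orientation: adjacent vertices are incomparable, the
  out-neighbours of a vertex form a chain, an arrow starting strictly below \<open>z\<close> ends strictly below
  \<open>z\<close> (\<open>arrow_stays_below\<close>), and an arrow entering the vertices strictly below \<open>z\<close> starts at an
  in-neighbour of \<open>z\<close> (\<open>arrow_enters_below\<close>). The first two properties exclude triangles. Burling's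
  recursive construction yields finite stages such that every proper colouring of the \<open>k\<close>-th stage
  gives at least \<open>k\<close> colours to some distinguished chain, called a probe (\<open>colourful_probe\<close>).

  By the last two properties the vertices strictly below \<open>z\<close> are separated from all other vertices
  by the closed neighbourhood of \<open>z\<close>. Hence, if an induced subgraph stays connected when the closed
  neighbourhood of any vertex is deleted, then a vertex \<open>z\<close> with something below it has all its
  non-neighbours below it; if in addition every vertex is far from some edge, then at most one vertex
  \<open>y\<close> of the subgraph has anything below it. Without \<open>y\<close> the subgraph is an antichain, so that every
  vertex has at most one out-neighbour, and the subgraph is sparse. A graph whose vertex-deleted
  subgraphs are too dense for that is therefore not an induced subgraph of Burling's graph
  (\<open>not_induced_in_Burling\<close>).

  These conditions, together with a few weaker ones that make them inductive, are collected in the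
  locale \<open>robust_graph\<close>. They are preserved when an edge is subdivided (\<open>robust_graph_subdivide\<close>) and
  they hold for the cube (\<open>robust_graph_cube\<close>), hence for all its subdivisions.
\<close>

section \<open>Burling's graph\<close>

text \<open>
  Stage \<open>k + 1\<close> of Burling's construction consists of a copy of stage \<open>k\<close> (the vertices \<open>Outer x\<close>),
  for each probe \<open>P\<close> of stage \<open>k\<close> another copy of stage \<open>k\<close> (the vertices \<open>Inner P x\<close>) and, for each
  pair of probes \<open>P\<close>, \<open>Q\<close> of stage \<open>k\<close>, a vertex \<open>Diag P Q\<close> joined to the vertices of \<open>Q\<close> in the copy
  that belongs to \<open>P\<close>. Each such pair gives rise to two new probes: \<open>Low P Q\<close> extends the outer copy
  of \<open>P\<close> by the inner copy of \<open>Q\<close>, and \<open>Up P Q\<close> extends it by the vertex \<open>Diag P Q\<close>. Stage \<open>0\<close> is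
  empty, with the empty probe \<open>Void\<close>. The terms of the two datatypes record this history of a probe
  and of a vertex; order and adjacency depend on the terms alone and not on the stage.
\<close>

datatype probe = Void | Low probe probe | Up probe probe

datatype vert = Outer vert | Inner probe vert | Diag probe probe

instance probe :: countable by countable_datatype
instance vert :: countable by countable_datatype

text \<open>The set of vertices that make up a probe.\<close>

primrec elems :: "probe \<Rightarrow> vert set" where
  "elems Void = {}"
| "elems (Low P Q) = Outer ` elems P \<union> Inner P ` elems Q"
| "elems (Up P Q) = insert (Diag P Q) (Outer ` elems P)"

text \<open>
  The strict order: everything in the copy that belongs to \<open>P\<close>, and each \<open>Diag P Q\<close>, is placed below
  the vertices of the outer copy of \<open>P\<close>.
\<close>

fun below :: "vert \<Rightarrow> vert \<Rightarrow> bool" where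
  "below (Outer x) (Outer y) \<longleftrightarrow> below x y"
| "below (Inner P x) (Outer y) \<longleftrightarrow> y \<in> elems P"
| "below (Inner P x) (Inner P' y) \<longleftrightarrow> P = P' \<and> below x y"
| "below (Diag P Q) (Outer y) \<longleftrightarrow> y \<in> elems P"
| "below _ _ \<longleftrightarrow> False"

text \<open>The edges, each oriented away from the vertex \<open>Diag P Q\<close> that introduced it.\<close>

fun arrow :: "vert \<Rightarrow> vert \<Rightarrow> bool" where
  "arrow (Outer x) (Outer y) \<longleftrightarrow> arrow x y"
| "arrow (Inner P x) (Inner P' y) \<longleftrightarrow> P = P' \<and> arrow x y"
| "arrow (Diag P Q) (Inner P' x) \<longleftrightarrow> P = P' \<and> x \<in> elems Q"
| "arrow _ _ \<longleftrightarrow> False"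

definition adj :: "vert \<Rightarrow> vert \<Rightarrow> bool" where
  "adj x y \<longleftrightarrow> arrow x y \<or> arrow y x"

lemma adj_sym: "adj x y \<longleftrightarrow> adj y x"
  by (auto simp: adj_def)

lemma below_asym: "below x y \<Longrightarrow> \<not> below y x"
  by (induction x y rule: below.induct) auto

lemma below_irrefl: "\<not> below x x"
  using below_asym by blast

text \<open>
  Probes are upward closed chains. This makes \<open>below\<close> a forest order in \<open>above_chain\<close>, and is what
  \<open>arrow_enters_below\<close> and \<open>arrow_chain\<close> need for the arrows out of \<open>Diag P Q\<close>.
\<close>

lemma elems_chain: "x \<in> elems P \<Longrightarrow> y \<in> elems P \<Longrightarrow> x = y \<or> below x y \<or> below y x"
  by (induction P arbitrary: x y) (auto, blast+)

lemma elems_upward_closed: "x \<in> elems P \<Longrightarrow> below x z \<Longrightarrow> z \<in> elems P"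
proof (induction P arbitrary: x z)
  case (Low P Q)
  then show ?case by (cases z) auto
next
  case (Up P Q)
  then show ?case by (cases z) auto
qed simp

lemma above_chain: "below x y \<Longrightarrow> below x z \<Longrightarrow> y = z \<or> below y z \<or> below z y"
proof (induction x arbitrary: y z)
  case (Outer x)
  then show ?case by (cases y; cases z) auto
next
  case (Inner P x)
  then show ?case by (cases y; cases z) (auto dest: elems_chain)
next
  case (Diag P Q)
  then show ?case by (cases y; cases z) (auto dest: elems_chain)
qed

lemma arrow_incomparable: "arrow x y \<Longrightarrow> \<not> below x y \<and> \<not> below y x"
  by (induction x y rule: arrow.induct) auto

lemma arrow_irrefl: "\<not> arrow x x"
  by (induction x) auto

text \<open>
  The next two lemmas say that an edge between a vertex strictly below \<open>z\<close> and a vertex not below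
  \<open>z\<close> has the latter end among the in-neighbours of \<open>z\<close>.
\<close>

lemma arrow_stays_below: "arrow x y \<Longrightarrow> below x z \<Longrightarrow> below y z"
proof (induction x y arbitrary: z rule: arrow.induct)
  case (1 x y)
  then show ?case by (cases z) auto
next
  case (2 P x P' y)
  then show ?case by (cases z) auto
next
  case (3 P Q P' x)
  then show ?case by (cases z) auto
qed auto

lemma arrow_enters_below: "arrow x y \<Longrightarrow> below y z \<Longrightarrow> below x z \<or> arrow x z"
proof (induction x y arbitrary: z rule: arrow.induct)
  case (1 x y)
  then show ?case by (cases z) auto
next
  case (2 P x P' y)
  then show ?case by (cases z) auto
next
  case (3 P Q P' x)
  then show ?case by (cases z) (auto dest: elems_upward_closed)
qed auto

lemma arrow_chain: "arrow x y \<Longrightarrow> arrow x z \<Longrightarrow> y = z \<or> below y z \<or> below z y"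
proof (induction x arbitrary: y z)
  case (Outer x)
  then show ?case by (cases y; cases z) auto
next
  case (Inner P x)
  then show ?case by (cases y; cases z) auto
next
  case (Diag P Q)
  then show ?case by (cases y; cases z) (auto dest: elems_chain)
qed

lemma arrow_acyclic3: "arrow x y \<Longrightarrow> arrow y z \<Longrightarrow> \<not> arrow z x"
proof (induction x y arbitrary: z rule: arrow.induct)
  case (1 x y)
  then show ?case by (cases z) auto
next
  case (2 P x P' y)
  then show ?case by (cases z) auto
next
  case (3 P Q P' x)
  then show ?case by (cases z) auto
qed auto

text \<open>
  A triangle is either cyclically oriented or has a vertex with two adjacent, hence incomparable,
  out-neighbours.
\<close>

lemma adj_triangle_free:
  assumes "adj x y" "adj y z" shows "\<not> adj x z"
  using assms arrow_chain arrow_incomparable arrow_acyclic3 arrow_irrefl unfolding adj_def by metis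

section \<open>The chromatic number of the finite stages\<close>

text \<open>The probes and the vertices of the \<open>k\<close>-th stage of the construction.\<close>

primrec probes :: "nat \<Rightarrow> probe set" where
  "probes 0 = {Void}"
| "probes (Suc k) = (\<lambda>(P, Q). Low P Q) ` (probes k \<times> probes k) \<union>
    (\<lambda>(P, Q). Up P Q) ` (probes k \<times> probes k)"

primrec stage :: "nat \<Rightarrow> vert set" where
  "stage 0 = {}"
| "stage (Suc k) = Outer ` stage k \<union> (\<lambda>(P, x). Inner P x) ` (probes k \<times> stage k) \<union>
    (\<lambda>(P, Q). Diag P Q) ` (probes k \<times> probes k)"

lemma stage_Suc_iff:
  "Outer x \<in> stage (Suc k) \<longleftrightarrow> x \<in> stage k"
  "Inner P x \<in> stage (Suc k) \<longleftrightarrow> P \<in> probes k \<and> x \<in> stage k"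
  "Diag P Q \<in> stage (Suc k) \<longleftrightarrow> P \<in> probes k \<and> Q \<in> probes k"
  by auto

lemma probes_Suc_iff:
  "Low P Q \<in> probes (Suc k) \<longleftrightarrow> P \<in> probes k \<and> Q \<in> probes k"
  "Up P Q \<in> probes (Suc k) \<longleftrightarrow> P \<in> probes k \<and> Q \<in> probes k"
  by auto

lemma finite_probes: "finite (probes k)"
  by (induction k) auto

lemma finite_stage: "finite (stage k)"
  by (induction k) (auto simp: finite_probes)

lemma finite_elems: "finite (elems P)"
  by (induction P) auto

lemma elems_subset_stage: "P \<in> probes k \<Longrightarrow> elems P \<subseteq> stage k"
proof (induction k arbitrary: P)
  case (Suc k)
  have "elems (Low P Q) \<subseteq> stage (Suc k) \<and> elems (Up P Q) \<subseteq> stage (Suc k)"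
    if "P \<in> probes k" "Q \<in> probes k" for P Q
    using Suc.IH[OF that(1)] Suc.IH[OF that(2)] that by auto
  moreover obtain Q R where "Q \<in> probes k" "R \<in> probes k" "P = Low Q R \<or> P = Up Q R"
    using Suc.prems by auto
  ultimately show ?case by metis
qed simp

text \<open>
  Burling's colouring argument. The induction hypothesis gives a probe \<open>P\<close> with \<open>k\<close> colours in the
  outer copy and a probe \<open>Q\<close> with \<open>k\<close> colours in the copy that belongs to \<open>P\<close>. If \<open>Q\<close> shows a colour
  not occurring on \<open>P\<close>, then \<open>Low P Q\<close> has \<open>k + 1\<close> colours. Otherwise the colour of \<open>Diag P Q\<close>, which
  differs from all colours of \<open>Q\<close>, gives the probe \<open>Up P Q\<close> one colour more than \<open>Q\<close>.
\<close>

lemma colourful_probe: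
  assumes "\<And>x y. x \<in> stage k \<Longrightarrow> y \<in> stage k \<Longrightarrow> arrow x y \<Longrightarrow> c x \<noteq> c y"
  shows "\<exists>P\<in>probes k. k \<le> card (c ` elems P)"
  using assms
proof (induction k arbitrary: c)
  case 0
  then show ?case by simp
next
  case (Suc k)
  have "\<exists>P\<in>probes k. k \<le> card ((c \<circ> Outer) ` elems P)"
  proof (rule Suc.IH)
    fix x y assume "x \<in> stage k" "y \<in> stage k" "arrow x y"
    then show "(c \<circ> Outer) x \<noteq> (c \<circ> Outer) y"
      using Suc.prems[of "Outer x" "Outer y"] by (simp del: stage.simps add: stage_Suc_iff)
  qed
  then obtain P where P: "P \<in> probes k" "k \<le> card (c ` Outer ` elems P)"
    unfolding image_comp by blast
  have "\<exists>Q\<in>probes k. k \<le> card ((c \<circ> Inner P) ` elems Q)"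
  proof (rule Suc.IH)
    fix x y assume "x \<in> stage k" "y \<in> stage k" "arrow x y"
    then show "(c \<circ> Inner P) x \<noteq> (c \<circ> Inner P) y"
      using Suc.prems[of "Inner P x" "Inner P y"] P(1)
      by (simp del: stage.simps add: stage_Suc_iff)
  qed
  then obtain Q where Q: "Q \<in> probes k" "k \<le> card (c ` Inner P ` elems Q)"
    unfolding image_comp by blast
  let ?A = "c ` Outer ` elems P" and ?B = "c ` Inner P ` elems Q"
  have fin: "finite ?A" "finite ?B" by (simp_all add: finite_elems)
  show ?case
  proof (cases "?B \<subseteq> ?A")
    case False
    have "card ?A < card (?A \<union> ?B)"
    proof (rule psubset_card_mono)
      show "finite (?A \<union> ?B)" using fin by simp
      show "?A \<subset> ?A \<union> ?B" using False by blast
    qed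
    then have "Suc k \<le> card (c ` elems (Low P Q))"
      using P(2) by (simp add: image_Un)
    moreover have "Low P Q \<in> probes (Suc k)" using P Q by (simp only: probes_Suc_iff)
    ultimately show ?thesis by blast
  next
    case True
    have "c (Diag P Q) \<notin> ?B"
    proof
      assume "c (Diag P Q) \<in> ?B"
      then obtain q where q: "q \<in> elems Q" "c (Diag P Q) = c (Inner P q)" by auto
      have "q \<in> stage k" using q Q elems_subset_stage by blast
      then have "c (Diag P Q) \<noteq> c (Inner P q)"
        using Suc.prems[of "Diag P Q" "Inner P q"] P(1) Q(1) q(1)
        by (simp del: stage.simps add: stage_Suc_iff)
      then show False using q by simp
    qed
    then have "card ?B < card (insert (c (Diag P Q)) ?A)"
    proof (intro psubset_card_mono psubsetI)
      show "finite (insert (c (Diag P Q)) ?A)" using fin by simp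
      show "?B \<subseteq> insert (c (Diag P Q)) ?A" using True by blast
      show "?B \<noteq> insert (c (Diag P Q)) ?A" using \<open>c (Diag P Q) \<notin> ?B\<close> by blast
    qed
    then have "Suc k \<le> card (c ` elems (Up P Q))"
      using Q(2) by simp
    moreover have "Up P Q \<in> probes (Suc k)" using P Q by (simp only: probes_Suc_iff)
    ultimately show ?thesis by blast
  qed
qed

section \<open>Robust graphs and their subdivisions\<close>

text \<open>
  For a symmetric relation \<open>E\<close>, the subgraph induced by \<open>X\<close> is connected: some edge leaves every
  proper nonempty part of \<open>X\<close>. The empty set counts as connected.
\<close>

definition connected_in :: "'a rel \<Rightarrow> 'a set \<Rightarrow> bool" where
  "connected_in E X \<longleftrightarrow>
     (\<forall>A. A \<subseteq> X \<longrightarrow> A \<noteq> {} \<longrightarrow> A \<noteq> X \<longrightarrow> (\<exists>a\<in>A. \<exists>b\<in>X - A. (a, b) \<in> E))"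

lemma connected_inD:
  assumes "connected_in E X" "A \<subseteq> X" "A \<noteq> {}" "A \<noteq> X"
  obtains a b where "a \<in> A" "b \<in> X" "b \<notin> A" "(a, b) \<in> E"
  using assms unfolding connected_in_def by (metis DiffD1 DiffD2)

lemma connected_in_mono:
  assumes "connected_in E X" "\<And>a b. a \<in> X \<Longrightarrow> b \<in> X \<Longrightarrow> (a, b) \<in> E \<Longrightarrow> (a, b) \<in> E'"
  shows "connected_in E' X"
  using assms unfolding connected_in_def by (metis DiffD1 subsetD)

text \<open>
  The new vertex \<open>w\<close> must be joined to \<open>X\<close>, and it may replace edges inside \<open>X\<close> by paths of length
  two. This covers both adding a vertex and subdividing an edge.
\<close>

lemma connected_in_insert:
  assumes "connected_in E X" "sym E'" "x \<in> X" "(x, w) \<in> E'"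
    and "\<And>a b. a \<in> X \<Longrightarrow> b \<in> X \<Longrightarrow> (a, b) \<in> E \<Longrightarrow> (a, b) \<in> E' \<or> (a, w) \<in> E' \<and> (w, b) \<in> E'"
  shows "connected_in E' (insert w X)"
  unfolding connected_in_def
proof (intro allI impI)
  fix A assume A: "A \<subseteq> insert w X" "A \<noteq> {}" "A \<noteq> insert w X"
  have wx: "(w, x) \<in> E'" using assms by (meson symD)
  show "\<exists>a\<in>A. \<exists>b\<in>insert w X - A. (a, b) \<in> E'"
  proof -
    consider "A \<inter> X = {}" | "X \<subseteq> A" | "A \<inter> X \<noteq> {}" "A \<inter> X \<noteq> X" by blast
    then show ?thesis
    proof cases
      case 1
      then have "w \<in> A" "x \<in> insert w X - A" using A assms(3) by auto
      then show ?thesis using wx by blast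
    next
      case 2
      then have "x \<in> A" "w \<in> insert w X - A" using A assms(3) by auto
      then show ?thesis using assms(4) by blast
    next
      case 3
      then obtain a b where ab: "a \<in> A \<inter> X" "b \<in> X" "b \<notin> A \<inter> X" "(a, b) \<in> E"
        using connected_inD[OF assms(1), of "A \<inter> X"] by (metis inf_le2)
      then consider "(a, b) \<in> E'" | "(a, w) \<in> E'" "(w, b) \<in> E'" using assms(5) by blast
      then show ?thesis using ab by cases blast+
    qed
  qed
qed

lemma connected_in_dominating_edge:
  assumes "sym E" "c \<in> X" "d \<in> X" "(c, d) \<in> E"
    and dom: "\<And>x. x \<in> X \<Longrightarrow> (c, x) \<in> E \<or> (d, x) \<in> E"
  shows "connected_in E X"
  unfolding connected_in_def
proof (intro allI impI)
  fix A assume A: "A \<subseteq> X" "A \<noteq> {}" "A \<noteq> X"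
  then obtain a b where ab: "a \<in> A" "b \<in> X - A" by blast
  then have "(c, a) \<in> E \<or> (d, a) \<in> E" "(c, b) \<in> E \<or> (d, b) \<in> E"
    using dom A by blast+
  moreover have "(y, x) \<in> E" if "(x, y) \<in> E" for x y
    using assms(1) that by (rule symD)
  ultimately show "\<exists>a\<in>A. \<exists>b\<in>X - A. (a, b) \<in> E"
    using ab assms(2-4) by (cases "c \<in> A"; cases "d \<in> A") blast+
qed

text \<open>The closed neighbourhood of a vertex.\<close>

definition nbh :: "'a rel \<Rightarrow> 'a \<Rightarrow> 'a set" where
  "nbh E u = insert u {v. (u, v) \<in> E}"

text \<open>
  The conditions that keep a graph from being induced in Burling's graph are \<open>nonempty\<close>,
  \<open>triangle_free\<close>, \<open>connected_del_nbh\<close>, \<open>distant_edge\<close> (every vertex \<open>y\<close> admits an edge that avoids its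
  closed neighbourhood) and \<open>not_functional\<close>. The last one says that the graph without \<open>y\<close> has no
  orientation in which every vertex has at most one out-neighbour; such an orientation is given by
  the function \<open>g\<close> that sends each vertex to its out-neighbour, with arbitrary values elsewhere. The
  other conditions serve to preserve \<open>connected_del_nbh\<close> under subdivision of an edge \<open>uv\<close>: the
  closed neighbourhood of the new vertex is that vertex with \<open>u\<close> and \<open>v\<close>, and \<open>v\<close> leaves the closed
  neighbourhood of \<open>u\<close>, so that it needs another neighbour to stay attached.
\<close>

locale robust_graph = pair_graph G for G :: "'a pair_pre_digraph" +
  assumes nonempty: "pverts G \<noteq> {}"
    and triangle_free: "(x, y) \<in> parcs G \<Longrightarrow> (y, z) \<in> parcs G \<Longrightarrow> (x, z) \<notin> parcs G"
    and second_neighbour: "(x, y) \<in> parcs G \<Longrightarrow> \<exists>z. z \<noteq> y \<and> (x, z) \<in> parcs G"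
    and connected_del_vertex: "y \<in> pverts G \<Longrightarrow> connected_in (parcs G) (pverts G - {y})"
    and connected_del_edge: "(x, y) \<in> parcs G \<Longrightarrow> connected_in (parcs G) (pverts G - {x, y})"
    and connected_del_nbh: "y \<in> pverts G \<Longrightarrow> connected_in (parcs G) (pverts G - nbh (parcs G) y)"
    and distant_edge:
      "y \<in> pverts G \<Longrightarrow> \<exists>a b. (a, b) \<in> parcs G \<and> a \<notin> nbh (parcs G) y \<and> b \<notin> nbh (parcs G) y"
    and not_functional:
      "y \<in> pverts G \<Longrightarrow> \<exists>a b. (a, b) \<in> parcs G \<and> a \<noteq> y \<and> b \<noteq> y \<and> g a \<noteq> b \<and> g b \<noteq> a"

lemma (in robust_graph) robust_graph_subdivide:
  assumes uv: "(u, v) \<in> parcs G" and w: "w \<notin> pverts G"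
  shows "robust_graph (subdivide G (u, v) w)"
proof -
  let ?V = "pverts G" and ?E = "parcs G"
  define E' where "E' = parcs (subdivide G (u, v) w)"
  have E': "E' = ?E - {(u, v), (v, u)} \<union> {(u, w), (w, u), (w, v), (v, w)}"
    by (simp add: E'_def)
  have V': "pverts (subdivide G (u, v) w) = insert w ?V" by simp
  interpret S: pair_graph "subdivide G (u, v) w"
    using uv w by (rule pair_graph_subdivide)
  have symE: "(b, a) \<in> ?E" if "(a, b) \<in> ?E" for a b using that by (rule arcs_symmetric)
  have sym': "sym E'" using symE by (auto simp: E' sym_def)
  have vu: "(v, u) \<in> ?E" using symE uv .
  have inV: "u \<in> ?V" "v \<in> ?V" using uv in_arcsD1 in_arcsD2 by auto
  have ne: "u \<noteq> v" "u \<noteq> w" "v \<noteq> w" using uv no_loops' w inV by auto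
  have wE: "(a, w) \<notin> ?E" "(w, a) \<notin> ?E" for a using w in_arcsD1 in_arcsD2 by auto
  have loop: "(a, a) \<notin> ?E" for a using no_loops' by blast
  \<comment> \<open>The new vertex can be added to a connected set that contains an end of the subdivided edge.\<close>
  have add_w: "connected_in E' (insert w X)" if X: "connected_in ?E X" "u \<in> X \<or> v \<in> X" for X
  proof -
    obtain x where "x \<in> X" "(x, w) \<in> E'" using X(2) E' by auto
    then show ?thesis
      using connected_in_insert[OF X(1) sym'] by (auto simp: E')
  qed
  \<comment> \<open>Removing the edge \<open>uv\<close> does not disconnect the graph, as \<open>u\<close> has a second neighbour; and by its
    second neighbour, which is not adjacent to \<open>u\<close>, \<open>v\<close> is attached to the non-neighbours of \<open>u\<close>.\<close>
  have add_u: "connected_in E' ?V \<and> connected_in E' (insert v (?V - nbh ?E u))"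
    if uv: "(u, v) \<in> ?E"
      and uvE': "\<And>a b. (a, b) \<in> ?E \<Longrightarrow> (a, b) \<noteq> (u, v) \<Longrightarrow> (a, b) \<noteq> (v, u) \<Longrightarrow> (a, b) \<in> E'"
    for u v
  proof -
    have in2: "u \<in> ?V" "v \<in> ?V" using uv in_arcsD1 in_arcsD2 by auto
    obtain x where x: "x \<noteq> v" "(u, x) \<in> ?E" using second_neighbour[OF uv] by auto
    have "connected_in E' (insert u (?V - {u}))"
      by (rule connected_in_insert[OF connected_del_vertex[OF in2(1)] sym', of x])
        (use x uvE' symE loop in_arcsD2 in auto)
    moreover have "insert u (?V - {u}) = ?V" using in2 by auto
    moreover obtain z where z: "z \<noteq> u" "(v, z) \<in> ?E" using second_neighbour[OF symE[OF uv]] by auto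
    have "(u, z) \<notin> ?E" using triangle_free uv z by blast
    then have "connected_in E' (insert v (?V - nbh ?E u))"
      by (intro connected_in_insert[OF connected_del_nbh[OF in2(1)] sym', of z])
        (use z uvE' symE loop in_arcsD2 in \<open>auto simp: nbh_def\<close>)
    ultimately show ?thesis by simp
  qed
  have kept: "(a, b) \<in> E'" if "(a, b) \<in> ?E" "(a, b) \<noteq> (u, v)" "(a, b) \<noteq> (v, u)" for a b
    using that by (auto simp: E')
  have E'_w: "(w, a) \<in> E' \<longleftrightarrow> a \<in> {u, v}" "(a, w) \<in> E' \<longleftrightarrow> a \<in> {u, v}" for a
    using wE by (auto simp: E')
  have E'_old: "(a, b) \<in> ?E" if "(a, b) \<in> E'" "a \<noteq> w" "b \<noteq> w" for a b
    using that by (auto simp: E')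
  have not_uv: "(a, b) \<notin> E'" if "a \<in> {u, v}" "b \<in> {u, v}" for a b
    using that ne loop by (auto simp: E')
  have nbh_w: "nbh E' w = {w, u, v}"
    using wE by (auto simp: nbh_def E')
  have nbh_u: "nbh E' u = insert w (nbh ?E u - {v})" "nbh E' v = insert w (nbh ?E v - {u})"
    using ne by (auto simp: nbh_def E')
  have nbh_other: "nbh E' y = nbh ?E y" if "y \<noteq> u" "y \<noteq> v" "y \<noteq> w" for y
    using that by (auto simp: nbh_def E')
  show ?thesis
  proof (unfold_locales, unfold V' E'_def[symmetric])
    show "insert w ?V \<noteq> {}" by simp
  next
    fix x y z assume xyz: "(x, y) \<in> E'" "(y, z) \<in> E'"
    show "(x, z) \<notin> E'"
    proof
      assume xz: "(x, z) \<in> E'"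
      have "x \<noteq> w" "y \<noteq> w" "z \<noteq> w"
        using xyz xz E'_w not_uv by metis+
      then show False using xyz xz E'_old triangle_free by blast
    qed
  next
    fix x y assume xy: "(x, y) \<in> E'"
    show "\<exists>z. z \<noteq> y \<and> (x, z) \<in> E'"
    proof (cases "x = w \<or> x = u \<or> x = v")
      case True
      obtain p q where "p \<noteq> v" "(u, p) \<in> ?E" "q \<noteq> u" "(v, q) \<in> ?E"
        using second_neighbour uv vu by metis
      then have "(u, p) \<in> E'" "(v, q) \<in> E'" "p \<noteq> w" "q \<noteq> w" using ne wE by (auto simp: E')
      moreover have "(w, u) \<in> E'" "(w, v) \<in> E'" "(u, w) \<in> E'" "(v, w) \<in> E'" by (auto simp: E')
      ultimately show ?thesis using True ne by metis
    next
      case False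
      then have "(x, y) \<in> ?E" using xy by (auto simp: E')
      then obtain z where "z \<noteq> y" "(x, z) \<in> ?E" using second_neighbour by blast
      then show ?thesis using False by (auto simp: E')
    qed
  next
    fix y assume y: "y \<in> insert w ?V"
    show "connected_in E' (insert w ?V - {y})"
    proof (cases "y = w")
      case True
      then have "insert w ?V - {y} = ?V" using w by auto
      then show ?thesis using add_u[OF uv] kept by auto
    next
      case False
      then have "insert w ?V - {y} = insert w (?V - {y})" by auto
      moreover have "connected_in E' (insert w (?V - {y}))"
        by (rule add_w, rule connected_del_vertex) (use y False inV ne in auto)
      ultimately show ?thesis by simp
    qed
  next
    fix x y assume xy: "(x, y) \<in> E'"
    have del: "connected_in E' (?V - {a})" if "a \<in> {u, v}" for a
      using that inV by (intro connected_in_mono[OF connected_del_vertex]) (auto simp: E')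
    consider "x = w" "y \<in> {u, v}" | "y = w" "x \<in> {u, v}" | "(x, y) \<in> ?E" "(x, y) \<noteq> (u, v)" "(x, y) \<noteq> (v, u)"
      using xy wE by (auto simp: E')
    then show "connected_in E' (insert w ?V - {x, y})"
    proof cases
      case 1
      then have "insert w ?V - {x, y} = ?V - {y}" using w by auto
      then show ?thesis using del 1 by simp
    next
      case 2
      then have "insert w ?V - {x, y} = ?V - {x}" using w by auto
      then show ?thesis using del 2 by simp
    next
      case 3
      then have "insert w ?V - {x, y} = insert w (?V - {x, y})" using wE by auto
      moreover have "connected_in E' (insert w (?V - {x, y}))"
        by (rule add_w, rule connected_del_edge) (use 3 inV ne loop in auto)
      ultimately show ?thesis by simp
    qed
  next
    fix y assume y: "y \<in> insert w ?V"
    consider "y = w" | "y = u" | "y = v" | "y \<noteq> u" "y \<noteq> v" "y \<noteq> w" by blast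
    then show "connected_in E' (insert w ?V - nbh E' y)"
    proof cases
      case 1
      have "connected_in E' (?V - {u, v})"
        by (rule connected_in_mono[OF connected_del_edge[OF uv]]) (auto simp: E')
      moreover have "insert w ?V - nbh E' y = ?V - {u, v}" using 1 w by (auto simp: nbh_w)
      ultimately show ?thesis by simp
    next
      case 2
      have "insert w ?V - nbh E' y = insert v (?V - nbh ?E u)"
        using 2 w ne inV by (auto simp: nbh_u)
      then show ?thesis using add_u[OF uv] kept by auto
    next
      case 3
      have "insert w ?V - nbh E' y = insert u (?V - nbh ?E v)"
        using 3 w ne inV by (auto simp: nbh_u)
      then show ?thesis using add_u[OF vu] kept by auto
    next
      case 4
      have "insert w ?V - nbh E' y = insert w (?V - nbh ?E y)"
        using 4 wE by (auto simp: nbh_other) (auto simp: nbh_def)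
      moreover have "connected_in E' (insert w (?V - nbh ?E y))"
        by (rule add_w, rule connected_del_nbh)
          (use 4 y inV triangle_free[of y u v] uv in \<open>auto simp: nbh_def\<close>)
      ultimately show ?thesis by simp
    qed
  next
    fix y assume y: "y \<in> insert w ?V"
    \<comment> \<open>For \<open>y = w\<close>, an edge far from \<open>u\<close> also avoids \<open>v\<close>, since \<open>v\<close> is a neighbour of \<open>u\<close>.\<close>
    define t where "t = (if y = w then u else y)"
    have "t \<in> ?V" using y inV by (auto simp: t_def)
    then obtain a b where ab: "(a, b) \<in> ?E" "a \<notin> nbh ?E t" "b \<notin> nbh ?E t"
      using distant_edge by blast
    have "a \<noteq> w" "b \<noteq> w" using ab wE by auto
    show "\<exists>a b. (a, b) \<in> E' \<and> a \<notin> nbh E' y \<and> b \<notin> nbh E' y"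
    proof (cases "(a, b) = (u, v) \<or> (a, b) = (v, u)")
      case True
      then have "(a, w) \<in> E'" by (auto simp: E')
      moreover have y: "y \<noteq> u" "y \<noteq> v" "y \<noteq> w" "t = y"
        using True ab by (auto simp: t_def nbh_def split: if_splits)
      moreover have "w \<notin> nbh ?E y" using y wE by (auto simp: nbh_def)
      moreover have "a \<notin> nbh ?E y" using ab y by simp
      ultimately show ?thesis using nbh_other by metis
    next
      case False
      then have "(a, b) \<in> E'" using ab kept by auto
      moreover have "nbh E' y \<subseteq> insert w (nbh ?E t)"
        using uv wE by (auto simp: t_def nbh_def E' split: if_splits)
      ultimately show ?thesis using ab \<open>a \<noteq> w\<close> \<open>b \<noteq> w\<close> by blast
    qed
  next
    fix y :: 'a and g :: "'a \<Rightarrow> 'a" assume y: "y \<in> insert w ?V"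
    define t where "t = (if y = w then u else y)"
    \<comment> \<open>An orientation of the subdivided graph induces one of the original graph: the edge \<open>uv\<close> gets
      the direction of whichever of the arcs \<open>uw\<close>, \<open>vw\<close> points towards \<open>w\<close>.\<close>
    define g' where "g' x = (if g x \<noteq> w then g x else if x = u then v else u)" for x
    have "t \<in> ?V" using y inV by (auto simp: t_def)
    then obtain a b where ab: "(a, b) \<in> ?E" "a \<noteq> t" "b \<noteq> t" "g' a \<noteq> b" "g' b \<noteq> a"
      using not_functional by blast
    have abw: "a \<noteq> w" "b \<noteq> w" using ab wE by auto
    show "\<exists>a b. (a, b) \<in> E' \<and> a \<noteq> y \<and> b \<noteq> y \<and> g a \<noteq> b \<and> g b \<noteq> a"
    proof (cases "(a, b) = (u, v) \<or> (a, b) = (v, u)")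
      case True
      then have "y \<noteq> u" "y \<noteq> v" "y \<noteq> w" using ab by (auto simp: t_def split: if_splits)
      moreover have "g u \<noteq> w" "g v \<noteq> w"
        using True ab ne by (auto simp: g'_def split: if_splits)
      moreover have "g w \<noteq> u \<or> g w \<noteq> v" using ne by auto
      moreover have "(u, w) \<in> E'" "(v, w) \<in> E'" by (auto simp: E')
      ultimately show ?thesis by blast
    next
      case False
      then have "(a, b) \<in> E'" using ab kept by auto
      moreover have "g a \<noteq> b" "g b \<noteq> a" using ab abw by (auto simp: g'_def split: if_splits)
      moreover have "a \<noteq> y" "b \<noteq> y" using ab abw by (auto simp: t_def split: if_splits)
      ultimately show ?thesis by blast
    qed
  qed
qed

lemma (in robust_graph) robust_graph_subdivision:
  assumes "subdivision_pair G S"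
  shows "robust_graph S"
  using assms
proof (induct rule: subdivision_pair_induct)
  case base
  show ?case by unfold_locales
next
  case (divide e w S)
  interpret S: robust_graph S by fact
  show ?case using divide S.robust_graph_subdivide by (cases e) auto
qed

section \<open>Robust graphs are not induced in Burling's graph\<close>

lemma (in robust_graph) not_induced_in_Burling:
  fixes f :: "'a \<Rightarrow> vert"
  assumes inj: "inj_on f (pverts G)"
    and adj: "\<And>x y. x \<in> pverts G \<Longrightarrow> y \<in> pverts G \<Longrightarrow> (x, y) \<in> parcs G \<longleftrightarrow> adj (f x) (f y)"
  shows False
proof -
  let ?V = "pverts G" and ?E = "parcs G"
  have incomp: "\<not> below (f x) (f y)" if "(x, y) \<in> ?E" for x y
    using that adj[of x y] in_arcsD1 in_arcsD2 arrow_incomparable by (auto simp: adj_def)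
  \<comment> \<open>The closed neighbourhood of \<open>y\<close> separates what lies below \<open>y\<close> from the rest, so the rest is
    empty.\<close>
  have rest_below: "below (f x) (f y)"
    if y: "y \<in> ?V" "d \<in> ?V" "below (f d) (f y)" and x: "x \<in> ?V" "x \<noteq> y" "(y, x) \<notin> ?E" for x y d
  proof (rule ccontr)
    assume not_below: "\<not> below (f x) (f y)"
    let ?X = "?V - nbh ?E y"
    let ?A = "{a \<in> ?X. below (f a) (f y)}"
    have "d \<in> ?A"
      using y incomp[OF arcs_symmetric] below_irrefl by (auto simp: nbh_def)
    moreover have "x \<in> ?X - ?A" using x not_below by (auto simp: nbh_def)
    ultimately have "?A \<noteq> {}" "?A \<noteq> ?X" by blast+
    then obtain a b where ab: "a \<in> ?A" "b \<in> ?X" "b \<notin> ?A" "(a, b) \<in> ?E"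
      by (rule connected_inD[OF connected_del_nbh[OF y(1)], rotated]) auto
    then have "adj (f a) (f b)" using adj by auto
    then show False
      using ab arrow_stays_below[of "f a" "f b" "f y"] arrow_enters_below[of "f b" "f a" "f y"]
        adj[of y b] y(1) by (auto simp: nbh_def adj_def)
  qed
  \<comment> \<open>Two such vertices \<open>y\<close>, \<open>y'\<close> are adjacent, hence incomparable; the non-neighbours of \<open>y\<close> lie
    below \<open>y\<close>, thus not below \<open>y'\<close>, and are all adjacent to \<open>y'\<close>. An edge among them closes a
    triangle.\<close>
  have unique: "y = y'"
    if y: "y \<in> ?V" "d \<in> ?V" "below (f d) (f y)"
      and y': "y' \<in> ?V" "d' \<in> ?V" "below (f d') (f y')" for y y' d d'
  proof (rule ccontr)
    assume "y \<noteq> y'"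
    have yy': "(y, y') \<in> ?E"
      using rest_below[OF y, of y'] rest_below[OF y', of y] y y' \<open>y \<noteq> y'\<close> below_asym arcs_symmetric
      by metis
    obtain a b where ab: "(a, b) \<in> ?E" "a \<notin> nbh ?E y" "b \<notin> nbh ?E y"
      using distant_edge y by blast
    have "(y', z) \<in> ?E" if z: "z \<in> ?V" "z \<notin> nbh ?E y" for z
    proof (rule ccontr)
      assume "(y', z) \<notin> ?E"
      then have "below (f z) (f y')" "below (f z) (f y)"
        using rest_below[OF y', of z] rest_below[OF y, of z] z yy' by (auto simp: nbh_def)
      then have "f y = f y' \<or> below (f y) (f y') \<or> below (f y') (f y)"
        by (metis above_chain)
      then show False
        using incomp[OF yy'] incomp[OF arcs_symmetric[OF yy']] inj y y' \<open>y \<noteq> y'\<close>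
        by (auto dest: inj_onD)
    qed
    then show False using ab triangle_free in_arcsD1 in_arcsD2 by metis
  qed
  obtain y where y: "y \<in> ?V" "\<And>z d. z \<in> ?V \<Longrightarrow> d \<in> ?V \<Longrightarrow> z \<noteq> y \<Longrightarrow> \<not> below (f d) (f z)"
  proof (cases "\<exists>y\<in>?V. \<exists>d\<in>?V. below (f d) (f y)")
    case True
    then obtain y d where yd: "y \<in> ?V" "d \<in> ?V" "below (f d) (f y)" by blast
    then show ?thesis using that[of y] unique[OF yd] by metis
  next
    case False
    then show ?thesis using that nonempty by blast
  qed
  \<comment> \<open>The vertices other than \<open>y\<close> are pairwise incomparable, and out-neighbours form a chain.\<close>
  define g where "g a = (SOME b. b \<in> ?V \<and> b \<noteq> y \<and> arrow (f a) (f b))" for a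
  have g: "g a = b" if "b \<in> ?V" "b \<noteq> y" "arrow (f a) (f b)" for a b
  proof -
    have "g a \<in> ?V \<and> g a \<noteq> y \<and> arrow (f a) (f (g a))"
      unfolding g_def by (rule someI) (use that in blast)
    then have "f (g a) = f b" "g a \<in> ?V"
      using that y(2) arrow_chain by blast+
    then show ?thesis using inj that by (auto dest: inj_onD)
  qed
  obtain a b where "(a, b) \<in> ?E" "a \<noteq> y" "b \<noteq> y" "g a \<noteq> b" "g b \<noteq> a"
    using not_functional y(1) by blast
  then show False
    using g adj[of a b] in_arcsD1 in_arcsD2 by (auto simp: adj_def)
qed

section \<open>The cube\<close>

text \<open>
  The 3-cube, drawn as the complete bipartite graph between \<open>{0, 1, 2, 3}\<close> and \<open>{4, 5, 6, 7}\<close> without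
  the perfect matching that joins \<open>x\<close> to \<open>x + 4\<close>; matched vertices are the antipodes of the cube.
\<close>

definition cube :: "nat pair_pre_digraph" where
  "cube = \<lparr>pverts = {0, 1, 2, 3, 4, 5, 6, 7}, parcs =
    {(0,5), (0,6), (0,7), (1,4), (1,6), (1,7), (2,4), (2,5), (2,7), (3,4), (3,5), (3,6),
     (5,0), (6,0), (7,0), (4,1), (6,1), (7,1), (4,2), (5,2), (7,2), (4,3), (5,3), (6,3)}\<rparr>"

lemma robust_graph_cube: "robust_graph cube"
proof -
  have sym: "sym (parcs cube)"
    by (simp add: cube_def sym_def)
  let ?V = "pverts cube" and ?E = "parcs cube"
  have arcs: "\<forall>e\<in>?E. fst e \<in> ?V \<and> snd e \<in> ?V \<and> (fst e < 4 \<longleftrightarrow> \<not> snd e < 4) \<and>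
      (\<exists>z\<in>?V. z \<noteq> snd e \<and> (fst e, z) \<in> ?E)"
    by (simp add: cube_def)
  have in_verts: "x \<in> ?V" "y \<in> ?V" and bipartite: "x < 4 \<longleftrightarrow> \<not> y < 4"
    and two_neighbours: "\<exists>z. z \<noteq> y \<and> (x, z) \<in> ?E" if "(x, y) \<in> ?E" for x y
    using bspec[OF arcs that] unfolding fst_conv snd_conv by blast+
  \<comment> \<open>The antipode of a vertex. For an edge \<open>xy\<close>, the antipodes of \<open>x\<close> and \<open>y\<close> are adjacent, and each
    vertex other than \<open>x\<close> and \<open>y\<close> is adjacent to one of them. The non-neighbours of \<open>y\<close> form a star
    centred at the antipode of \<open>y\<close>.\<close>
  define p :: "nat \<Rightarrow> nat" where "p x = (x + 4) mod 8" for x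
  have opposite: "\<forall>e\<in>?E. p (fst e) \<in> ?V \<and> p (snd e) \<in> ?V \<and>
      p (fst e) \<noteq> fst e \<and> p (fst e) \<noteq> snd e \<and>
      p (snd e) \<noteq> fst e \<and> p (snd e) \<noteq> snd e \<and> (p (fst e), p (snd e)) \<in> ?E \<and>
      (\<forall>z\<in>?V. z = fst e \<or> z = snd e \<or> (p (fst e), z) \<in> ?E \<or> (p (snd e), z) \<in> ?E)"
    by (simp add: cube_def p_def)
  have del_edge: "connected_in ?E (?V - {x, y})" if "(x, y) \<in> ?E" for x y
    by (rule connected_in_dominating_edge[OF sym, of "p x" _ "p y"])
      (use bspec[OF opposite that, unfolded fst_conv snd_conv] in blast)+
  have "\<forall>y\<in>?V. p y \<in> ?V - nbh ?E y \<and>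
      (\<exists>d\<in>?V. d \<notin> nbh ?E y \<and> (p y, d) \<in> ?E) \<and> (\<forall>z\<in>?V. z \<in> nbh ?E y \<or> z = p y \<or> (p y, z) \<in> ?E)"
    by (simp add: cube_def nbh_def p_def)
  then have del_nbh: "connected_in ?E (?V - nbh ?E y)"
    and distant: "\<exists>a b. (a, b) \<in> ?E \<and> a \<notin> nbh ?E y \<and> b \<notin> nbh ?E y" if y: "y \<in> ?V" for y
  proof -
    assume *: "\<forall>y\<in>?V. p y \<in> ?V - nbh ?E y \<and>
      (\<exists>d\<in>?V. d \<notin> nbh ?E y \<and> (p y, d) \<in> ?E) \<and> (\<forall>z\<in>?V. z \<in> nbh ?E y \<or> z = p y \<or> (p y, z) \<in> ?E)"
    obtain d where d: "p y \<in> ?V - nbh ?E y" "d \<in> ?V - nbh ?E y" "(p y, d) \<in> ?E"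
      using bspec[OF * y] by blast
    show "connected_in ?E (?V - nbh ?E y)"
      by (rule connected_in_dominating_edge[OF sym d]) (use bspec[OF * y] d(3) symD[OF sym] in blast)
    show "\<exists>a b. (a, b) \<in> ?E \<and> a \<notin> nbh ?E y \<and> b \<notin> nbh ?E y" using d by blast
  qed
  have del_vertex: "connected_in ?E (?V - {x})" if x: "x \<in> ?V" for x
  proof -
    have "\<forall>x\<in>?V. \<exists>y\<in>?V. (x, y) \<in> ?E \<and> x \<noteq> y \<and> (\<exists>z\<in>?V. z \<noteq> x \<and> z \<noteq> y \<and> (z, y) \<in> ?E)"
      by (simp add: cube_def)
    then obtain y z where yz: "y \<in> ?V" "(x, y) \<in> ?E" "x \<noteq> y" "z \<in> ?V - {x, y}" "(z, y) \<in> ?E"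
      using x by (metis DiffI insertE empty_iff)
    have "connected_in ?E (insert y (?V - {x, y}))"
      by (rule connected_in_insert[OF del_edge[OF yz(2)] sym yz(4,5)]) blast
    moreover have "insert y (?V - {x, y}) = ?V - {x}" using yz by blast
    ultimately show ?thesis by simp
  qed
  \<comment> \<open>Nine edges, each counted as two arcs, remain when a vertex is deleted.\<close>
  have card_arcs: "\<forall>y\<in>?V. card {e \<in> ?E. fst e \<noteq> y \<and> snd e \<noteq> y} = 18"
    by code_simp
  show ?thesis
  proof (unfold_locales)
    show "fst e \<in> ?V" "snd e \<in> ?V" "fst e \<noteq> snd e" if "e \<in> ?E" for e
      using bspec[OF arcs that] by metis+
  next
    show "finite (pverts cube)" "finite (parcs cube)" "pverts cube \<noteq> {}" by (simp_all add: cube_def)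
  next
    show "symmetric (with_proj cube)" using sym by (simp add: symmetric_def)
  next
    fix x y z assume "(x, y) \<in> parcs cube" "(y, z) \<in> parcs cube"
    then show "(x, z) \<notin> parcs cube" using bipartite by blast
  next
    fix x y assume "(x, y) \<in> parcs cube"
    then show "\<exists>z. z \<noteq> y \<and> (x, z) \<in> parcs cube" using two_neighbours by blast
  next
    fix y assume "y \<in> pverts cube"
    then show "connected_in (parcs cube) (pverts cube - {y})"
      by (rule del_vertex)
  next
    fix x y assume "(x, y) \<in> parcs cube"
    then show "connected_in (parcs cube) (pverts cube - {x, y})"
      by (rule del_edge)
  next
    fix y assume "y \<in> pverts cube"
    then show "connected_in (parcs cube) (pverts cube - nbh (parcs cube) y)"
      by (rule del_nbh)
  next
    fix y assume "y \<in> pverts cube"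
    then show "\<exists>a b. (a, b) \<in> parcs cube \<and> a \<notin> nbh (parcs cube) y \<and> b \<notin> nbh (parcs cube) y"
      by (rule distant)
  next
    fix y :: nat and g :: "nat \<Rightarrow> nat"
    assume y: "y \<in> pverts cube"
    show "\<exists>a b. (a, b) \<in> parcs cube \<and> a \<noteq> y \<and> b \<noteq> y \<and> g a \<noteq> b \<and> g b \<noteq> a"
    proof (rule ccontr)
      \<comment> \<open>Seven out-neighbours account for at most fourteen of the eighteen arcs.\<close>
      assume functional: "\<not> ?thesis"
      let ?L = "{e \<in> parcs cube. fst e \<noteq> y \<and> snd e \<noteq> y}"
      let ?A = "(\<lambda>a. (a, g a)) ` (pverts cube - {y})" and ?B = "(\<lambda>a. (g a, a)) ` (pverts cube - {y})"
      have fin: "finite (pverts cube)" and card: "card (pverts cube - {y}) = 7"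
        using y by (simp_all add: cube_def card_Diff_singleton)
      have card7: "card (h ` (pverts cube - {y})) \<le> 7" for h :: "nat \<Rightarrow> nat \<times> nat"
        using card_image_le[of "pverts cube - {y}" h] fin unfolding card by blast
      have "?L \<subseteq> ?A \<union> ?B"
      proof
        fix e assume "e \<in> ?L"
        moreover obtain a b where "e = (a, b)" by (cases e)
        moreover have "a \<in> pverts cube" "b \<in> pverts cube" if "(a, b) \<in> parcs cube"
          using in_verts[OF that] by simp_all
        ultimately show "e \<in> ?A \<union> ?B" using functional by auto
      qed
      then have "card ?L \<le> card (?A \<union> ?B)"
        by (intro card_mono) (simp_all add: fin)
      also have "\<dots> \<le> card ?A + card ?B" by (rule card_Un_le)
      also have "\<dots> \<le> 7 + 7"
        by (intro add_mono card7)
      finally show False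
        using bspec[OF card_arcs y] by simp
    qed
  qed
qed

section \<open>Burling's graphs on the natural numbers\<close>

lemma clique_number_triangle_free:
  assumes "pair_graph G"
    and "\<And>x y z. (x, y) \<in> parcs G \<Longrightarrow> (y, z) \<in> parcs G \<Longrightarrow> (x, z) \<notin> parcs G"
  shows "clique_number G \<le> 2"
proof -
  interpret pair_graph G by fact
  have small: "card K \<le> 2" if K: "is_clique G K" for K
  proof (rule ccontr)
    assume "\<not> card K \<le> 2"
    then obtain T where "T \<subseteq> K" "card T = 3"
      using obtain_subset_with_card_n[of 3 K] by auto
    then obtain x y z where "x \<in> K" "y \<in> K" "z \<in> K" "x \<noteq> y" "y \<noteq> z" "x \<noteq> z"
      unfolding card_3_iff by auto
    then show False using K assms(2) unfolding is_clique_def by metis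
  qed
  have "is_clique G {}" by (simp add: is_clique_def)
  then have "{card K |K. is_clique G K} \<noteq> {}" by blast
  moreover have "finite {card K |K. is_clique G K}"
    by (rule finite_subset[of _ "{..2}"]) (use small in auto)
  ultimately show ?thesis
    unfolding clique_number_def using small by (subst Max_le_iff) auto
qed

lemma proper_colouring_chromatic_number:
  assumes "pair_graph G"
  shows "\<exists>c. proper_colouring G (chromatic_number G) c"
proof -
  interpret pair_graph G by fact
  obtain c :: "'a \<Rightarrow> nat" and n where "c ` pverts G = {i. i < n}" "inj_on c (pverts G)"
    using finite_imp_inj_to_nat_seg[OF pair_finite_verts] by auto
  then have "proper_colouring G n c"
    unfolding proper_colouring_def using in_arcsD1 in_arcsD2 no_loops'
    by auto (metis inj_onD)
  then have "\<exists>k c. proper_colouring G k c" by blast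
  then show ?thesis unfolding chromatic_number_def by (rule LeastI_ex)
qed

text \<open>The \<open>k\<close>-th Burling graph, with its vertices encoded as natural numbers.\<close>

definition burling :: "nat \<Rightarrow> nat pair_pre_digraph" where
  "burling k = \<lparr>pverts = to_nat ` stage k,
     parcs = {(to_nat x, to_nat y) |x y. x \<in> stage k \<and> y \<in> stage k \<and> adj x y}\<rparr>"

lemma burling_simps:
  "pverts (burling k) = to_nat ` stage k"
  "(a, b) \<in> parcs (burling k) \<longleftrightarrow>
     (\<exists>x\<in>stage k. \<exists>y\<in>stage k. a = to_nat x \<and> b = to_nat y \<and> adj x y)"
  by (auto simp: burling_def)

lemma pair_graph_burling: "pair_graph (burling k)"
proof
  have "parcs (burling k) \<subseteq> pverts (burling k) \<times> pverts (burling k)"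
    by (auto simp: burling_def)
  then show "finite (parcs (burling k))"
    by (rule finite_subset) (simp add: burling_simps finite_stage)
  show "symmetric (with_proj (burling k))"
    by (auto simp: symmetric_def sym_def burling_simps adj_sym)
qed (auto simp: burling_def finite_stage adj_def arrow_irrefl)

lemma clique_number_burling: "clique_number (burling k) \<le> 2"
  by (rule clique_number_triangle_free[OF pair_graph_burling])
    (auto simp: burling_simps dest: adj_triangle_free)

lemma chromatic_number_burling: "k \<le> chromatic_number (burling k)"
proof -
  obtain c where c: "proper_colouring (burling k) (chromatic_number (burling k)) c"
    using proper_colouring_chromatic_number[OF pair_graph_burling] by blast
  have "(c \<circ> to_nat) x \<noteq> (c \<circ> to_nat) y" if "x \<in> stage k" "y \<in> stage k" "arrow x y" for x y
  proof -
    have "(to_nat x, to_nat y) \<in> parcs (burling k)"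
      using that by (auto simp: burling_def adj_def)
    then show ?thesis using c by (auto simp: proper_colouring_def)
  qed
  then obtain P where P: "P \<in> probes k" "k \<le> card ((c \<circ> to_nat) ` elems P)"
    using colourful_probe[of k "c \<circ> to_nat"] by blast
  have "(c \<circ> to_nat) ` elems P \<subseteq> {..<chromatic_number (burling k)}"
    using elems_subset_stage[OF P(1)] c by (auto simp: proper_colouring_def burling_simps)
  then have "card ((c \<circ> to_nat) ` elems P) \<le> chromatic_number (burling k)"
    using card_mono[OF finite_lessThan] by force
  then show ?thesis using P(2) by simp
qed

lemma burling_no_induced_cube: "\<not> has_induced_subdivision (burling k) cube"
proof
  assume "has_induced_subdivision (burling k) cube"
  then obtain S T h where ST: "subdivision_pair cube S" "induced_subgraph T (with_proj (burling k))"
    and h: "pre_digraph.digraph_isomorphism (with_proj S) h" "T = app_iso h (with_proj S)"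
    unfolding has_induced_subdivision_def digraph_iso_def by blast
  interpret S: robust_graph S
    by (rule robust_graph.robust_graph_subdivision[OF robust_graph_cube ST(1)])
  define f where "f = iso_verts h"
  have sub: "subgraph T (with_proj (burling k))"
    and arcs_T: "arcs T = {e \<in> parcs (burling k). fst e \<in> verts T \<and> snd e \<in> verts T}"
    using ST(2) by (auto simp: induced_subgraph_def subgraph_def compatible_def)
  \<comment> \<open>As a subgraph, \<open>T\<close> inherits its incidence maps from \<open>burling k\<close>, so the isomorphism maps arcs as
    it maps their ends.\<close>
  have proj: "iso_tail h = fst" "iso_head h = snd"
    using sub h(2) by (auto simp: subgraph_def compatible_def app_iso_def)
  have inj: "inj_on f (pverts S)"
    using h(1) by (simp add: pre_digraph.digraph_isomorphism_def f_def)
  have iso_arc: "iso_arcs h e = (f (fst e), f (snd e))" if "e \<in> parcs S" for e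
    using h(1) that by (simp add: pre_digraph.digraph_isomorphism_def f_def proj prod_eq_iff)
  have verts_T: "verts T = f ` pverts S" by (simp add: h(2) f_def)
  have verts_sub: "f x \<in> to_nat ` stage k" if "x \<in> pverts S" for x
    using sub that verts_T by (auto simp: subgraph_def burling_simps)
  have arcs_iff: "(x, y) \<in> parcs S \<longleftrightarrow> (f x, f y) \<in> parcs (burling k)"
    if xy: "x \<in> pverts S" "y \<in> pverts S" for x y
  proof
    assume "(x, y) \<in> parcs S"
    then have "(f x, f y) \<in> arcs T" using iso_arc by (force simp: h(2))
    then show "(f x, f y) \<in> parcs (burling k)" by (simp add: arcs_T)
  next
    assume "(f x, f y) \<in> parcs (burling k)"
    then have "(f x, f y) \<in> arcs T" using xy by (simp add: arcs_T verts_T)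
    then obtain e where e: "e \<in> parcs S" "(f x, f y) = iso_arcs h e"
      by (auto simp: h(2))
    then have "f (fst e) = f x" "f (snd e) = f y" using iso_arc by auto
    then have "e = (x, y)"
      using inj xy e(1) S.in_arcsD1 S.in_arcsD2 by (metis inj_onD prod.collapse)
    then show "(x, y) \<in> parcs S" using e by simp
  qed
  have from_to: "to_nat (from_nat (f x) :: vert) = f x" "(from_nat (f x) :: vert) \<in> stage k"
    if x: "x \<in> pverts S" for x
  proof -
    obtain a :: vert where "f x = to_nat a" "a \<in> stage k" using verts_sub[OF x] by blast
    then show "to_nat (from_nat (f x) :: vert) = f x" "(from_nat (f x) :: vert) \<in> stage k" by simp_all
  qed
  show False
  proof (rule S.not_induced_in_Burling)
    show "inj_on (\<lambda>x. from_nat (f x) :: vert) (pverts S)"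
      using inj from_to(1) by (intro inj_onI) (metis inj_onD)
  next
    fix x y assume xy: "x \<in> pverts S" "y \<in> pverts S"
    have "(f x, f y) \<in> parcs (burling k) \<longleftrightarrow> adj (from_nat (f x)) (from_nat (f y))"
    proof -
      obtain a b :: vert where "f x = to_nat a" "a \<in> stage k" "f y = to_nat b" "b \<in> stage k"
        using verts_sub[OF xy(1)] verts_sub[OF xy(2)] by blast
      then show ?thesis by (auto simp: burling_simps)
    qed
    then show "(x, y) \<in> parcs S \<longleftrightarrow> adj (from_nat (f x)) (from_nat (f y))"
      using arcs_iff[OF xy] by simp
  qed
qed

theorem mainTheorem2:
  shows "\<exists>H :: nat pair_pre_digraph. pair_graph H \<and>
    \<not> chi_bounded {G :: nat pair_pre_digraph. pair_graph G \<and> \<not> has_induced_subdivision G H}"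
proof (rule exI[of _ cube], rule conjI, rule_tac [2] notI)
  show "pair_graph cube"
    using robust_graph_cube by (simp add: robust_graph_def)
next
  assume "chi_bounded {G :: nat pair_pre_digraph. pair_graph G \<and> \<not> has_induced_subdivision G cube}"
  then obtain F :: "nat \<Rightarrow> nat"
    where F: "chromatic_number (burling k) \<le> F (clique_number (burling k))" for k
    unfolding chi_bounded_def using pair_graph_burling burling_no_induced_cube by blast
  define k where "k = Suc (Max (F ` {..2}))"
  have "k \<le> F (clique_number (burling k))"
    using F chromatic_number_burling order_trans by blast
  also have "\<dots> \<le> Max (F ` {..2})"
    using clique_number_burling by (intro Max_ge) auto
  finally show False by (simp add: k_def)
qed

end
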